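(* For every $q\in(0,1)$, every complex conjugate pair of (non-real) zeros of $\theta(q,\cdot)$ with negative real part belongs to the left open half-disk of radius $49.8$ centered at the origin, i.e. to $\{x\in\mathbb{C} : \mathrm{Re}\,x<0,\ |x|<49.8\}$.
   Context: The partial theta function is $\theta(q,x):=\sum_{j=0}^{\infty}q^{j(j+1)/2}x^j$, where $q\in(0,1)$ is a parameter and $x\in\mathbb{C}$ is the variable. For each fixed $q\in(0,1)$ it is an entire function of $x$ with real coefficients, so its non-real zeros come in complex conjugate pairs. *)

theory Defs
  imports Complex_Main
begin

definition partial_theta :: "real \<Rightarrow> complex \<Rightarrow> complex" where
  "partial_theta q x = (\<Sum>j. of_real q ^ (j * (j + 1) div 2) * x ^ j)"

text \<open>The series converges everywhere, so \<^const>\<open>suminf\<close> never takes its default value here.\<close>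

lemma summable_partial_theta:
  fixes q :: real and x :: complex
  assumes "0 < q" "q < 1"
  shows "summable (\<lambda>j. of_real q ^ (j * (j + 1) div 2) * x ^ j)"
proof -
  let ?f = "\<lambda>j. (of_real q :: complex) ^ (j * (j + 1) div 2) * x ^ j"
  have "(\<lambda>n. q ^ Suc n * norm x) \<longlonglongrightarrow> 0 * norm x"
    using assms by (intro tendsto_mult tendsto_const LIMSEQ_Suc[OF LIMSEQ_realpow_zero]) auto
  then have "\<forall>\<^sub>F n in sequentially. q ^ Suc n * norm x < 1 / 2"
    by (rule order_tendstoD) simp
  then obtain N where N: "\<And>n. n \<ge> N \<Longrightarrow> q ^ Suc n * norm x < 1 / 2"
    by (auto simp: eventually_sequentially)
  have step: "?f (Suc n) = of_real q ^ Suc n * x * ?f n" for n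
  proof -
    have "Suc n * (Suc n + 1) = n * (n + 1) + Suc n * 2"
      by (simp add: algebra_simps)
    then have "Suc n * (Suc n + 1) div 2 = n * (n + 1) div 2 + Suc n"
      by (metis div_mult_self1 add.commute mult.commute zero_neq_numeral)
    then show ?thesis
      by (simp only: power_add power_Suc mult_ac)
  qed
  have "norm (?f (Suc n)) \<le> 1 / 2 * norm (?f n)" if "n \<ge> N" for n
  proof -
    have "norm (?f (Suc n)) = (q ^ Suc n * norm x) * norm (?f n)"
      unfolding step using assms by (simp add: norm_mult norm_power)
    also have "\<dots> \<le> 1 / 2 * norm (?f n)"
      using N[OF that] by (intro mult_right_mono) auto
    finally show ?thesis .
  qed
  then show ?thesis
    by (intro summable_ratio_test[where c = "1/2" and N = N]) auto
qed

end

theory Submission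
  imports Defs "HOL-Analysis.Analysis"
begin

text \<open>Write \<open>q = exp (- T)\<close>. By the Jacobi triple product,
  \<open>\<theta>(x) + \<theta>(1/x)/x\<close> is a bilateral theta function \<open>\<Theta>(x)\<close> with zeros
  \<open>- 1 / q ^ m\<close>. If \<open>\<theta>(x) = 0\<close> and \<open>r = norm x\<close> is large, choose \<open>N\<close> nearest to \<open>ln r / T\<close> and put
  \<open>y = - x q ^ N\<close>, so that \<open>norm y\<close> lies between \<open>q powr (1/2)\<close> and \<open>q powr (- 1/2)\<close>. Quasi-periodicity
  of \<open>\<Theta>\<close> turns \<open>\<theta>(x) = 0\<close> into \<open>y - 1 = c \<theta>(1/x) / (x ^ N P)\<close> with \<open>c\<close> real, where
  \<open>P\<close> is the part of the triple product without zeros near \<open>y\<close>. Two facts clash unless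
  \<open>y\<close> is real. On the one hand \<open>norm P \<ge> exp (- 5 / T)\<close>, which is beaten by the Gaussian growth
  \<open>exp ((ln r)\<^sup>2 / (2 T))\<close> of \<open>\<Theta>\<close>, so \<open>y\<close> is very close to \<open>1\<close>. On the other hand
  \<open>Im y = Im (y - 1)\<close>, and the argument of the right-hand side is at most
  \<open>N + 10 / T\<^sup>2 + 1 / 10\<close> times that of \<open>y\<close>, which forces \<open>y - 1\<close> not to be so small.
  Arguments are measured throughout by their absolute sine, \<open>im_ratio\<close>, which is subadditive under
  multiplication and ignores real factors.\<close>

section \<open>The sine of the argument\<close>

text \<open>Division by zero gives the value 0 at \<open>z = 0\<close>, which lets the rules for
  products, powers and inverses hold without side conditions.\<close>

definition im_ratio :: "complex \<Rightarrow> real" where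
  "im_ratio z = \<bar>Im z\<bar> / cmod z"

lemma im_ratio_nonneg: "0 \<le> im_ratio z"
  by (simp add: im_ratio_def)

lemma abs_Im_eq_im_ratio: "\<bar>Im z\<bar> = im_ratio z * cmod z"
  by (cases "z = 0") (simp_all add: im_ratio_def)

text \<open>This is \<open>|sin (s + t)| <= |sin s| + |sin t|\<close>: the addition formula with
  both cosines bounded by 1.\<close>

lemma im_ratio_mult_le: "im_ratio (z * w) \<le> im_ratio z + im_ratio w"
proof (cases "z = 0 \<or> w = 0")
  case False
  have "\<bar>Im (z * w)\<bar> \<le> \<bar>Re z\<bar> * \<bar>Im w\<bar> + \<bar>Im z\<bar> * \<bar>Re w\<bar>"
    by (simp add: abs_mult[symmetric] abs_triangle_ineq)
  also have "\<dots> \<le> cmod z * \<bar>Im w\<bar> + \<bar>Im z\<bar> * cmod w"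
    by (intro add_mono mult_mono abs_Re_le_cmod) auto
  finally have "\<bar>Im (z * w)\<bar> / (cmod z * cmod w)
      \<le> (cmod z * \<bar>Im w\<bar> + \<bar>Im z\<bar> * cmod w) / (cmod z * cmod w)"
    by (intro divide_right_mono) auto
  also have "\<dots> = im_ratio z + im_ratio w"
    using False by (simp add: im_ratio_def field_simps)
  finally show ?thesis
    by (simp add: im_ratio_def norm_mult)
qed (auto simp: im_ratio_def)

lemma im_ratio_inverse: "im_ratio (inverse z) = im_ratio z"
proof (cases "z = 0")
  case False
  have "\<bar>Im (inverse z)\<bar> = \<bar>Im z\<bar> / (cmod z)\<^sup>2"
    by (simp add: cmod_power2)
  then have "im_ratio (inverse z) = \<bar>Im z\<bar> / (cmod z)\<^sup>2 / inverse (cmod z)"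
    by (simp only: im_ratio_def norm_inverse)
  also have "\<dots> = im_ratio z"
    using False by (simp add: im_ratio_def power2_eq_square)
  finally show ?thesis .
qed simp

lemma im_ratio_power_le: "im_ratio (z ^ n) \<le> real n * im_ratio z"
proof (induction n)
  case (Suc n)
  then show ?case
    using im_ratio_mult_le[of z "z ^ n"] by (simp add: algebra_simps)
qed (simp add: im_ratio_def)

lemma im_ratio_prod_le: "im_ratio (\<Prod>i<n. f i) \<le> (\<Sum>i<n. im_ratio (f i))" for n :: nat
proof (induction n)
  case (Suc n)
  then show ?case
    using im_ratio_mult_le[of "\<Prod>i<n. f i" "f n"] by simp
qed (simp add: im_ratio_def)

lemma im_ratio_of_real_mult: "c \<noteq> 0 \<Longrightarrow> im_ratio (of_real c * z) = im_ratio z"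
  by (simp add: im_ratio_def norm_mult abs_mult)

lemma im_ratio_mult_of_real: "c \<noteq> 0 \<Longrightarrow> im_ratio (z * of_real c) = im_ratio z"
  using im_ratio_of_real_mult[of c z] by (simp add: mult.commute)

lemma im_ratio_minus: "im_ratio (- z) = im_ratio z"
  by (simp add: im_ratio_def)

text \<open>Passing to \<open>1 - z\<close> changes the imaginary part only in sign and leaves a
  modulus of at least \<open>1 - cmod z\<close>. The bound stays proportional to
  \<open>im_ratio z\<close>, as the final comparison with \<open>im_ratio y\<close>
  requires.\<close>

lemma im_ratio_one_minus_le:
  assumes "cmod z < 1"
  shows "im_ratio (1 - z) \<le> im_ratio z * (cmod z / (1 - cmod z))"
proof -
  have "1 - cmod z \<le> cmod (1 - z)"
    using norm_triangle_ineq2[of 1 z] by simp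
  then have "\<bar>Im z\<bar> / cmod (1 - z) \<le> \<bar>Im z\<bar> / (1 - cmod z)"
    using assms by (intro divide_left_mono mult_pos_pos) auto
  then show ?thesis
    by (simp add: im_ratio_def[of "1 - z"] abs_Im_eq_im_ratio)
qed

lemma im_ratio_lim_le:
  assumes "f \<longlonglongrightarrow> l" "l \<noteq> 0" "\<And>n. im_ratio (f n) \<le> B"
  shows "im_ratio l \<le> B"
proof (rule LIMSEQ_le_const2)
  show "(\<lambda>n. im_ratio (f n)) \<longlonglongrightarrow> im_ratio l"
    unfolding im_ratio_def using assms by (intro tendsto_intros) auto
qed (use assms in auto)

section \<open>Bounds for the products of \<open>1 - z q ^ m\<close>\<close>

text \<open>This is \<open>h <= sinh h\<close>. For the quadratic Taylor polynomial \<open>u\<close>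
  of \<open>exp h\<close>, \<open>u * (u - 2 * h) = (1 + h^2 / 2)^2 - h^2 >= 1\<close>; hence
  \<open>exp (- h) <= 1 / u <= u - 2 * h\<close>, while \<open>u <= exp h\<close>.\<close>

lemma two_mult_le_exp_diff:
  fixes h :: real
  assumes "0 \<le> h"
  shows "2 * h \<le> exp h - exp (- h)"
proof -
  define u where "u = 1 + h + h\<^sup>2 / 2"
  have u: "1 \<le> u" "u \<le> exp h"
    using assms exp_lower_Taylor_quadratic[of h] by (auto simp: u_def)
  have "u * (u - 2 * h) - 1 = h ^ 4 / 4"
    by (simp add: u_def field_simps power2_eq_square power4_eq_xxxx)
  moreover have "0 \<le> h ^ 4 / 4"
    by simp
  ultimately have "1 \<le> u * (u - 2 * h)"
    by linarith
  then have "1 / u \<le> u - 2 * h"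
    using u by (simp add: divide_le_eq mult.commute)
  moreover have "exp (- h) \<le> 1 / u"
    using u by (simp add: exp_minus inverse_eq_divide frac_le)
  ultimately show ?thesis
    using u by linarith
qed

text \<open>The quadratic Taylor polynomial at \<open>s\<close> is too small for
  \<open>s > 2\<close>; squaring the one at \<open>s / 2\<close> supplies cubic and quartic terms
  that suffice.\<close>

lemma one_plus_square_le_exp:
  fixes s :: real
  assumes "0 \<le> s"
  shows "1 + s\<^sup>2 \<le> exp s"
proof -
  define u where "u = s / 2 + s\<^sup>2 / 8"
  have "1 + u \<le> exp (s / 2)"
    using assms exp_lower_Taylor_quadratic[of "s / 2"] by (simp add: u_def field_simps power2_eq_square)
  then have "(1 + u)\<^sup>2 \<le> exp (s / 2) ^ 2"
    using assms by (intro power_mono) (auto simp: u_def)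
  also have "\<dots> = exp s"
    by (simp add: power2_eq_square flip: exp_add)
  finally have "(1 + u)\<^sup>2 \<le> exp s" .
  moreover have "(1 + u)\<^sup>2 - (1 + s\<^sup>2) = s * ((s - 2)\<^sup>2 / 8 + 1 / 2) + s ^ 4 / 64"
    by (simp add: u_def field_simps power2_eq_square power4_eq_xxxx)
  moreover have "0 \<le> s * ((s - 2)\<^sup>2 / 8 + 1 / 2) + s ^ 4 / 64"
    using assms by simp
  ultimately show ?thesis
    by linarith
qed

text \<open>The term \<open>k = 0\<close> is 0, by division by zero. The term \<open>k = 1\<close>
  is kept exactly, and the others telescope through
  \<open>1 / k^2 <= 1 / (k - 1/2) - 1 / (k + 1/2)\<close>, which gives
  \<open>1 + 2/3\<close>.\<close>

lemma sum_inverse_squares_le: "(\<Sum>k<n. 1 / (real k)\<^sup>2) \<le> 5 / 3"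
proof -
  have "(\<Sum>k<n + 2. 1 / (real k)\<^sup>2) \<le> 5 / 3 - 1 / (real n + 3 / 2)" for n
  proof (induction n)
    case (Suc n)
    have "1 / (real n + 2)\<^sup>2 \<le> 1 / (real n + 3 / 2) - 1 / (real n + 5 / 2)"
      by (simp add: divide_simps) (simp add: power2_eq_square algebra_simps)
    then show ?case
      using Suc by (simp add: algebra_simps)
  qed (simp add: numeral_2_eq_2)
  from this[of n] have "(\<Sum>k<n + 2. 1 / (real k)\<^sup>2) \<le> 5 / 3"
    by (smt (verit) divide_nonneg_nonneg of_nat_0_le_iff)
  moreover have "(\<Sum>k<n. 1 / (real k)\<^sup>2) \<le> (\<Sum>k<n + 2. 1 / (real k)\<^sup>2)"
    by (intro sum_mono2) auto
  ultimately show ?thesis by linarith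
qed

text \<open>The first term is 4; for \<open>m >= 1\<close> the terms telescope through
  \<open>1 / (m + 1/2)^2 <= 1 / m - 1 / (m + 1)\<close> and add at most 1.\<close>

lemma sum_inverse_half_squares_le: "(\<Sum>m<n. 1 / (real m + 1 / 2)\<^sup>2) \<le> 5"
proof -
  have "(\<Sum>m<Suc n. 1 / (real m + 1 / 2)\<^sup>2) \<le> 5 - 1 / (real n + 1)" for n
  proof (induction n)
    case (Suc n)
    have "1 / (real n + 3 / 2)\<^sup>2 \<le> 1 / (real n + 1) - 1 / (real n + 2)"
      by (simp add: divide_simps) (simp add: power2_eq_square algebra_simps)
    then show ?case
      using Suc by (simp add: algebra_simps)
  qed (simp add: power2_eq_square)
  from this[of n] have "(\<Sum>m<Suc n. 1 / (real m + 1 / 2)\<^sup>2) \<le> 5"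
    by (smt (verit) divide_nonneg_nonneg of_nat_0_le_iff)
  moreover have "(\<Sum>m<n. 1 / (real m + 1 / 2)\<^sup>2) \<le> (\<Sum>m<Suc n. 1 / (real m + 1 / 2)\<^sup>2)"
    by (intro sum_mono2) auto
  ultimately show ?thesis by linarith
qed

text \<open>The double series of logarithms is summed over \<open>m\<close> first; this costs only the factor
  \<open>sqrt (2 pi / T) exp (T / 24)\<close> against the modular transformation of the product.\<close>

lemma exp_le_qprod:
  fixes b T :: real
  assumes T: "0 < T" and b: "0 \<le> b" "b \<le> exp (- T / 2)"
  shows "exp (- (5 / 3) / T) \<le> (\<Prod>m<M. 1 - b * exp (- T) ^ m)"
proof -
  define q where "q = exp (- T)"
  have q: "0 < q" "q < 1" using T by (auto simp: q_def)
  have b1: "b < 1" using b T by (smt (verit) exp_less_one_iff divide_less_0_iff)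
  have s1: "b * q ^ m < 1" "0 \<le> b * q ^ m" for m
    using b b1 q mult_left_le[of "q ^ m" b] power_le_one[of q m] by auto
  have "(\<lambda>k. - ((- (- (b * q ^ m))) ^ k) / real k) sums ln (1 + - (b * q ^ m))" for m
    using s1[of m] by (intro ln_series') auto
  then have "(\<lambda>k. \<Sum>m<M. - ((b * q ^ m) ^ k) / real k) sums (\<Sum>m<M. ln (1 - b * q ^ m))"
    by (intro sums_sum) simp
  then have lim: "(\<lambda>n. \<Sum>k<n. \<Sum>m<M. - ((b * q ^ m) ^ k) / real k) \<longlonglongrightarrow> (\<Sum>m<M. ln (1 - b * q ^ m))"
    by (simp add: sums_def)
  have term_ge: "- (1 / T) * (1 / (real k)\<^sup>2) \<le> (\<Sum>m<M. - ((b * q ^ m) ^ k) / real k)" for k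
  proof (cases "k = 0")
    case False
    define s where "s = real k * T"
    have s: "0 < s" using False T by (simp add: s_def)
    have qk: "q ^ k = exp (- s)" by (simp add: q_def s_def flip: exp_of_nat_mult)
    have "b ^ k \<le> exp (- T / 2) ^ k" using b by (intro power_mono) auto
    also have "\<dots> = exp (- s / 2)" by (simp add: s_def flip: exp_of_nat_mult)
    finally have bk: "b ^ k \<le> exp (- s / 2)" .
    \<comment> \<open>The quotient \<open>exp (- s / 2) / (1 - exp (- s))\<close> equals
      \<open>1 / (2 * sinh (s / 2))\<close>; the half power in the bound on \<open>b\<close>
      produces this symmetric form.\<close>
    have "exp (- s / 2) * s \<le> exp (- s / 2) * (exp (s / 2) - exp (- (s / 2)))"
      using two_mult_le_exp_diff[of "s / 2"] s by (intro mult_left_mono) auto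
    also have "\<dots> = 1 - exp (- s)"
      by (simp add: right_diff_distrib flip: exp_add)
    finally have 1: "exp (- s / 2) / (1 - exp (- s)) \<le> 1 / s"
      using s by (simp add: field_simps)
    have "(\<Sum>m<M. (b * q ^ m) ^ k) = b ^ k * (\<Sum>m<M. (q ^ k) ^ m)"
      by (simp add: power_mult_distrib sum_distrib_left power_mult[symmetric] mult.commute)
    also have "(\<Sum>m<M. (q ^ k) ^ m) \<le> 1 / (1 - q ^ k)"
    proof -
      have "(\<Sum>m<M. (q ^ k) ^ m) = (1 - (q ^ k) ^ M) / (1 - q ^ k)"
        using s by (subst sum_gp_strict) (simp add: qk)
      also have "\<dots> \<le> 1 / (1 - q ^ k)"
        using s q by (intro divide_right_mono) (auto simp: qk)
      finally show ?thesis .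
    qed
    then have "b ^ k * (\<Sum>m<M. (q ^ k) ^ m) \<le> exp (- s / 2) * (1 / (1 - q ^ k))"
      using bk b q by (intro mult_mono) (auto intro!: sum_nonneg)
    also have "\<dots> \<le> 1 / s" using 1 by (simp add: qk)
    finally have "(\<Sum>m<M. (b * q ^ m) ^ k) \<le> 1 / s" .
    then have "(\<Sum>m<M. (b * q ^ m) ^ k) / real k \<le> (1 / s) / real k"
      by (intro divide_right_mono) auto
    then show ?thesis
      by (simp add: s_def sum_negf sum_divide_distrib power2_eq_square mult_ac)
  qed simp
  have "- (5 / 3) / T \<le> (\<Sum>k<n. \<Sum>m<M. - ((b * q ^ m) ^ k) / real k)" for n
  proof -
    have "- (1 / T) * (5 / 3) \<le> - (1 / T) * (\<Sum>k<n. 1 / (real k)\<^sup>2)"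
      using T sum_inverse_squares_le[of n] by (intro mult_left_mono_neg) auto
    also have "\<dots> = (\<Sum>k<n. - (1 / T) * (1 / (real k)\<^sup>2))"
      by (simp add: sum_distrib_left)
    also have "\<dots> \<le> (\<Sum>k<n. \<Sum>m<M. - ((b * q ^ m) ^ k) / real k)"
      by (intro sum_mono term_ge)
    finally show ?thesis by simp
  qed
  then have "- (5 / 3) / T \<le> (\<Sum>m<M. ln (1 - b * q ^ m))"
    by (intro LIMSEQ_le_const[OF lim]) auto
  then have "exp (- (5 / 3) / T) \<le> exp (\<Sum>m<M. ln (1 - b * q ^ m))"
    by simp
  also have "\<dots> = (\<Prod>m<M. 1 - b * q ^ m)"
    using s1 by (simp add: exp_sum)
  finally show ?thesis by (simp add: q_def)
qed

lemma exp_le_cmod_qprod: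
  fixes z :: complex
  assumes T: "0 < T" and z: "cmod z \<le> exp (- T / 2)"
  shows "exp (- (5 / 3) / T) \<le> cmod (\<Prod>m<M. 1 - z * of_real (exp (- T)) ^ m)"
proof -
  have e: "exp (- T / 2) < 1" using T by simp
  have "exp (- (5 / 3) / T) \<le> (\<Prod>m<M. 1 - cmod z * exp (- T) ^ m)"
    using assms by (intro exp_le_qprod) auto
  also have "\<dots> \<le> (\<Prod>m<M. cmod (1 - z * of_real (exp (- T)) ^ m))"
  proof (intro prod_mono conjI)
    fix m
    have "cmod z * exp (- T) ^ m \<le> 1 * 1"
      using z e T by (intro mult_mono power_le_one) (auto intro: order.trans)
    then show "0 \<le> 1 - cmod z * exp (- T) ^ m" by simp
    have "norm (of_real (exp (- T)) :: complex) = exp (- T)" by simp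
    then have "cmod (z * of_real (exp (- T)) ^ m) = cmod z * exp (- T) ^ m"
      by (simp only: norm_mult norm_power)
    then show "1 - cmod z * exp (- T) ^ m \<le> cmod (1 - z * of_real (exp (- T)) ^ m)"
      using norm_triangle_ineq2[of 1 "z * of_real (exp (- T)) ^ m"] by simp
  qed
  also have "\<dots> = cmod (\<Prod>m<M. 1 - z * of_real (exp (- T)) ^ m)"
    by (simp add: prod_norm)
  finally show ?thesis .
qed

text \<open>With \<open>w = z * q^m\<close> and \<open>s = T * (m + 1/2)\<close>, a factor
  contributes at most \<open>cmod w / (1 - cmod w) <= 1 / (exp s - 1) <= 1 / s^2\<close> times
  \<open>im_ratio z\<close>. The square makes the sum over \<open>m\<close> converge, where
  \<open>1 / s\<close> would not.\<close>

lemma im_ratio_qprod_le: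
  fixes z :: complex
  assumes T: "0 < T" and z: "cmod z \<le> exp (- T / 2)"
  shows "im_ratio (\<Prod>m<M. 1 - z * of_real (exp (- T)) ^ m) \<le> im_ratio z * (5 / T\<^sup>2)"
proof -
  have factor: "im_ratio (1 - z * of_real (exp (- T)) ^ m)
      \<le> im_ratio z * ((1 / T\<^sup>2) * (1 / (real m + 1 / 2)\<^sup>2))" for m
  proof -
    define s where "s = T * (real m + 1 / 2)"
    have s: "0 < s" using T by (simp add: s_def)
    define w where "w = z * of_real (exp (- T)) ^ m"
    have "cmod w = cmod z * exp (- T) ^ m"
      by (simp add: w_def norm_mult norm_power del: of_real_exp exp_of_real)
    also have "\<dots> \<le> exp (- T / 2) * exp (- T) ^ m"
      using z by (intro mult_right_mono) auto
    also have "\<dots> = exp (- s)"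
      by (simp add: s_def algebra_simps flip: exp_of_nat_mult exp_add)
    finally have w: "cmod w \<le> exp (- s)" .
    also have "exp (- s) < 1" using s by simp
    finally have w1: "cmod w < 1" .
    have "im_ratio (1 - w) \<le> im_ratio w * (cmod w / (1 - cmod w))"
      by (rule im_ratio_one_minus_le[OF w1])
    also have "cmod w / (1 - cmod w) \<le> exp (- s) / (1 - exp (- s))"
      using w w1 s by (intro frac_le) auto
    also have "exp (- s) / (1 - exp (- s)) = 1 / (exp s - 1)"
      using s by (simp add: exp_minus field_simps)
    also have "\<dots> \<le> 1 / s\<^sup>2"
      using s one_plus_square_le_exp[of s] by (intro divide_left_mono) (auto simp: mult_pos_pos)
    also have "im_ratio w = im_ratio z"
      unfolding w_def of_real_power[symmetric] by (intro im_ratio_mult_of_real) simp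
    finally show ?thesis
      by (simp add: w_def s_def power_mult_distrib im_ratio_nonneg mult_left_mono)
  qed
  have "im_ratio (\<Prod>m<M. 1 - z * of_real (exp (- T)) ^ m)
      \<le> (\<Sum>m<M. im_ratio (1 - z * of_real (exp (- T)) ^ m))"
    by (rule im_ratio_prod_le)
  also have "\<dots> \<le> (\<Sum>m<M. im_ratio z * ((1 / T\<^sup>2) * (1 / (real m + 1 / 2)\<^sup>2)))"
    by (intro sum_mono factor)
  also have "\<dots> = im_ratio z * ((1 / T\<^sup>2) * (\<Sum>m<M. 1 / (real m + 1 / 2)\<^sup>2))"
    by (simp add: sum_distrib_left)
  also have "\<dots> \<le> im_ratio z * ((1 / T\<^sup>2) * 5)"
    using sum_inverse_half_squares_le by (intro mult_left_mono im_ratio_nonneg) auto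
  finally show ?thesis by simp
qed


section \<open>The Jacobi triple product\<close>

definition qpoch :: "'a::field \<Rightarrow> nat \<Rightarrow> 'a" where
  "qpoch q n = (\<Prod>i<n. 1 - q ^ Suc i)"

text \<open>The Gaussian binomial coefficient, with \<open>qpoch q n\<close> in the role of
  \<open>(q; q)_n\<close>. The value 0 for \<open>k > n\<close> is set explicitly because
  \<open>n - k\<close> truncates.\<close>

definition qbinom :: "'a::field \<Rightarrow> nat \<Rightarrow> nat \<Rightarrow> 'a" where
  "qbinom q n k = (if k \<le> n then qpoch q n / (qpoch q k * qpoch q (n - k)) else 0)"

lemma qpoch_0 [simp]: "qpoch q 0 = 1"
  by (simp add: qpoch_def)

lemma qpoch_Suc: "qpoch q (Suc n) = (1 - q ^ Suc n) * qpoch q n"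
  by (simp add: qpoch_def mult.commute)

lemma of_real_qpoch: "of_real (qpoch q n) = qpoch (of_real q :: complex) n"
  by (simp add: qpoch_def)

lemma triangular_Suc: "Suc k * (Suc k + 1) div 2 = k * (k + 1) div 2 + Suc k"
proof -
  have "Suc k * (Suc k + 1) = k * (k + 1) + Suc k * 2"
    by (simp add: algebra_simps)
  then show ?thesis
    by (metis div_mult_self1 add.commute mult.commute zero_neq_numeral)
qed

lemma double_triangular: "2 * (k * (k + 1) div 2) = k * (k + 1)" for k :: nat
  by simp

lemma triangular_add: "(a + b) * (a + b + 1) div 2 = a * (a + 1) div 2 + b * (b + 1) div 2 + a * b" for a b :: nat
proof (induction b)
  case (Suc b)
  then show ?case
    using triangular_Suc[of "a + b"] triangular_Suc[of b] by (simp add: algebra_simps)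
qed simp

context
  fixes q :: "'a::field"
  assumes q: "\<And>i. q ^ Suc i \<noteq> 1"
begin

lemma qpoch_nonzero: "qpoch q n \<noteq> 0"
  using q by (simp add: qpoch_def)

text \<open>The q-Pascal rule. For \<open>k < n\<close> the numerator factor splits as
  \<open>1 - q^(n+1) = (1 - q^(n-k)) + q^(n-k) * (1 - q^(k+1))\<close>, and each summand cancels one
  factor of the denominator.\<close>

lemma qbinom_Suc_Suc: "k \<le> n \<Longrightarrow> qbinom q (Suc n) (Suc k) = qbinom q n (Suc k) + q ^ (n - k) * qbinom q n k"
proof (cases "k = n")
  case True
  then show ?thesis using qpoch_nonzero by (simp add: qbinom_def)
next
  case False
  assume "k \<le> n"
  with False obtain d where d: "n = Suc (k + d)"
    by (metis le_imp_less_or_eq less_imp_Suc_add)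
  have e: "1 - q ^ Suc n = (1 - q ^ Suc d) + q ^ Suc d * (1 - q ^ Suc k)"
    by (simp add: d algebra_simps power_add)
  have nz: "qpoch q k \<noteq> 0" "qpoch q d \<noteq> 0" "1 - q ^ Suc k \<noteq> 0" "1 - q ^ Suc d \<noteq> 0"
    using q by (auto simp: qpoch_nonzero simp del: power_Suc)
  have diffs: "Suc n - Suc k = Suc d" "n - Suc k = d" "n - k = Suc d"
    by (auto simp: d)
  note rec = qpoch_Suc[of q n] qpoch_Suc[of q k] qpoch_Suc[of q d]
  have A: "qbinom q (Suc n) (Suc k)
      = ((1 - q ^ Suc n) * qpoch q n) / (((1 - q ^ Suc k) * qpoch q k) * ((1 - q ^ Suc d) * qpoch q d))"
    unfolding qbinom_def diffs rec using \<open>k \<le> n\<close> False by simp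
  have B: "qbinom q n (Suc k) = qpoch q n / (((1 - q ^ Suc k) * qpoch q k) * qpoch q d)"
    unfolding qbinom_def diffs rec using \<open>k \<le> n\<close> False by simp
  have C: "qbinom q n k = qpoch q n / (qpoch q k * ((1 - q ^ Suc d) * qpoch q d))"
    unfolding qbinom_def diffs rec using \<open>k \<le> n\<close> False by simp
  show ?thesis
    unfolding A B C e diffs using nz
    by (simp add: divide_simps del: power_Suc) (simp add: algebra_simps del: power_Suc)
qed

text \<open>By induction: the new factor \<open>1 + z * q ^ Suc n\<close> adds a shifted copy of the
  sum, and the q-Pascal rule matches coefficients because
  \<open>(n + 1) + k(k+1)/2 = (n - k) + (k+1)(k+2)/2\<close>.\<close>

lemma q_binomial:
  "(\<Prod>i<n. 1 + z * q ^ Suc i) = (\<Sum>k<Suc n. q ^ (k * (k + 1) div 2) * qbinom q n k * z ^ k)"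
proof (induction n)
  case 0
  show ?case by (simp add: qbinom_def)
next
  case (Suc n)
  let ?T = "\<lambda>k::nat. k * (k + 1) div 2"
  let ?c = "\<lambda>n k. q ^ ?T k * qbinom q n k * z ^ k"
  have "?c (Suc n) (Suc k) = ?c n (Suc k) + z * q ^ Suc n * ?c n k" if "k < Suc n" for k
  proof -
    have "Suc n + t = (n - k) + (t + Suc k)" for t using that by simp
    then have pow: "q ^ Suc n * q ^ ?T k = q ^ (n - k) * q ^ ?T (Suc k)"
      unfolding triangular_Suc power_add[symmetric] by (rule arg_cong)
    have pascal: "qbinom q (Suc n) (Suc k) = qbinom q n (Suc k) + q ^ (n - k) * qbinom q n k"
      using that by (intro qbinom_Suc_Suc) simp
    have regroup: "Q * (b + D * b') * (z * Z) = Q * b * (z * Z) + z * S * (R * b' * Z)"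
      if "S * R = D * Q" for Q D S R Z b b'
    proof -
      have "z * S * (R * b' * Z) = z * (S * R) * b' * Z" by (simp only: mult_ac)
      then show ?thesis unfolding that by (simp only: distrib_left distrib_right mult_ac)
    qed
    show ?thesis
      unfolding power_Suc[of z] pascal by (rule regroup[OF pow])
  qed
  then have "(\<Sum>k<Suc n. ?c (Suc n) (Suc k)) = (\<Sum>k<Suc n. ?c n (Suc k)) + z * q ^ Suc n * (\<Sum>k<Suc n. ?c n k)"
    by (simp only: sum.distrib[symmetric] sum_distrib_left) (intro sum.cong, auto)
  moreover have "?c (Suc n) 0 = ?c n 0"
    using qpoch_nonzero by (simp add: qbinom_def)
  moreover have "?c n (Suc n) = 0"
    by (simp add: qbinom_def)
  ultimately have "(\<Sum>k<Suc (Suc n). ?c (Suc n) k) = (\<Sum>k<Suc n. ?c n k) + z * q ^ Suc n * (\<Sum>k<Suc n. ?c n k)"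
    using sum.lessThan_Suc_shift[of "?c (Suc n)" "Suc n"] sum.lessThan_Suc_shift[of "?c n" "Suc n"]
      sum.lessThan_Suc[of "?c n" "Suc n"]
    by (simp only:) (simp add: algebra_simps)
  then show ?case
    using Suc.IH by (simp only: prod.lessThan_Suc) (simp add: algebra_simps)
qed

text \<open>The central case \<open>n = 2 M + 1\<close> of the \<open>q\<close>-binomial theorem, with \<open>z = x / q ^ (M + 1)\<close> and the
  terms of index \<open>M - j\<close> and \<open>M + 1 + j\<close> paired.\<close>

lemma finite_jacobi_triple_product:
  assumes x: "x \<noteq> 0" and q0: "q \<noteq> 0"
  shows "(\<Prod>m<M. 1 + x * q ^ Suc m) * (\<Prod>l<Suc M. 1 + q ^ l / x)
    = (\<Sum>j<Suc M. qpoch q (2 * M + 1) / (qpoch q (M - j) * qpoch q (M + 1 + j))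
          * (q ^ (j * (j + 1) div 2) * (x ^ j + 1 / x ^ Suc j)))"
proof -
  let ?T = "\<lambda>k::nat. k * (k + 1) div 2"
  let ?z = "x / q ^ Suc M"
  let ?c = "\<lambda>k. q ^ ?T k * qbinom q (2 * M + 1) k * ?z ^ k"
  let ?b = "\<lambda>j. qpoch q (2 * M + 1) / (qpoch q (M - j) * qpoch q (M + 1 + j))"
  have combine: "A * b * (X / B) = Y / D * (b * (C * E))" if "A / B = C / D" "X = Y * E" for A B C D E X Y b :: 'a
  proof -
    have "A * b * (X / B) = (A / B) * b * X" by simp
    then show ?thesis unfolding that by simp
  qed
  have split_prod: "(\<Prod>i<a + b. f i) = (\<Prod>i<a. f i) * (\<Prod>i<b. f (a + i))" for f :: "nat \<Rightarrow> 'a" and a b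
    by (induction b) (auto simp: mult.assoc)
  have split_sum: "(\<Sum>i<a + b. f i) = (\<Sum>i<a. f i) + (\<Sum>i<b. f (a + i))" for f :: "nat \<Rightarrow> 'a" and a b
    by (induction b) (auto simp: add.assoc)
  \<comment> \<open>The first \<open>M + 1\<close> factors, in reverse order and with
    \<open>x / q ^ l\<close> pulled out of each, become the factors
    \<open>1 + q ^ l / x\<close>.\<close>
  have "(\<Prod>i<Suc M. 1 + ?z * q ^ Suc i) = (\<Prod>i<Suc M. 1 + ?z * q ^ Suc (Suc M - Suc i))"
    by (rule prod.nat_diff_reindex[symmetric])
  also have "\<dots> = (\<Prod>l<Suc M. x / q ^ l * (1 + q ^ l / x))"
  proof (intro prod.cong refl)
    fix l assume "l \<in> {..<Suc M}"
    then have "q ^ Suc M = q ^ l * q ^ Suc (Suc M - Suc l)"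
      by (simp flip: power_add power_Suc)
    then show "1 + ?z * q ^ Suc (Suc M - Suc l) = x / q ^ l * (1 + q ^ l / x)"
      using x q0 by (simp add: field_simps del: power_Suc)
  qed
  also have "\<dots> = (\<Prod>l<Suc M. x / q ^ l) * (\<Prod>l<Suc M. 1 + q ^ l / x)"
    by (rule prod.distrib)
  also have "(\<Prod>l<Suc M. x / q ^ l) = x ^ Suc M / q ^ ?T M"
  proof (induction M)
    case (Suc M)
    then show ?case
      by (simp only: prod.lessThan_Suc[of _ "Suc M"] triangular_Suc power_add) simp
  qed simp
  finally have lower: "(\<Prod>i<Suc M. 1 + ?z * q ^ Suc i)
      = x ^ Suc M / q ^ ?T M * (\<Prod>l<Suc M. 1 + q ^ l / x)" .
  have upper: "(\<Prod>i<M. 1 + ?z * q ^ Suc (Suc M + i)) = (\<Prod>m<M. 1 + x * q ^ Suc m)"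
    using q0 by (intro prod.cong refl) (simp add: power_add)
  have "x ^ Suc M / q ^ ?T M * ((\<Prod>m<M. 1 + x * q ^ Suc m) * (\<Prod>l<Suc M. 1 + q ^ l / x))
      = (\<Prod>i<Suc M + M. 1 + ?z * q ^ Suc i)"
    unfolding split_prod lower upper by (simp only: mult_ac)
  also have "Suc M + M = 2 * M + 1" by simp
  also have "(\<Prod>i<2 * M + 1. 1 + ?z * q ^ Suc i) = (\<Sum>k<Suc (2 * M + 1). ?c k)"
    by (rule q_binomial)
  also have "Suc (2 * M + 1) = Suc M + Suc M" by simp
  also have "(\<Sum>k<Suc M + Suc M. ?c k) = (\<Sum>j<Suc M. ?c (Suc M - Suc j)) + (\<Sum>j<Suc M. ?c (Suc M + j))"
    unfolding split_sum sum.nat_diff_reindex[of ?c "Suc M"] by (rule refl)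
  also have "\<dots> = (\<Sum>j<Suc M. x ^ Suc M / q ^ ?T M * (?b j * (q ^ ?T j * (x ^ j + 1 / x ^ Suc j))))"
    unfolding sum.distrib[symmetric]
  proof (intro sum.cong refl)
    fix j assume "j \<in> {..<Suc M}"
    then obtain i where i: "M = i + j"
      by (metis add.commute le_iff_add lessThan_iff less_Suc_eq_le)
    \<comment> \<open>The exponent \<open>k(k+1)/2 - (M+1)k\<close> is a parabola in
      \<open>k\<close> symmetric about \<open>M + 1/2\<close>. At both paired indices
      \<open>M - j\<close> and \<open>M + 1 + j\<close> it equals
      \<open>j(j+1)/2 - M(M+1)/2\<close>, which is the content of \<open>e1\<close> and
      \<open>e2\<close>.\<close>
    have "?T M = ?T i + ?T j + i * j" unfolding i by (rule triangular_add)
    moreover have "u + v = w + Suc M * i" if "v = u + w + i * j" "2 * u = i * (i + 1)" for u v w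
      using that by (simp add: i algebra_simps)
    ultimately have e1: "?T i + ?T M = ?T j + Suc M * i"
      using double_triangular by blast
    have "?T (Suc M + j) = ?T (Suc M) + ?T j + Suc M * j" by (rule triangular_add)
    moreover have "?T (Suc M) + ?T M = Suc M * Suc M"
    proof -
      have "u + Suc M + u = Suc M * Suc M" if "2 * u = M * (M + 1)" for u
        using that by (simp add: algebra_simps)
      then show ?thesis
        unfolding triangular_Suc using double_triangular by blast
    qed
    ultimately have e2: "?T (Suc M + j) + ?T M = ?T j + Suc M * (Suc M + j)"
      by (simp only: distrib_left)
    have d: "Suc M - Suc j = i" "M - j = i" "2 * M + 1 - i = M + 1 + j" "2 * M + 1 - (Suc M + j) = i" 
       "i \<le> 2 * M + 1" "Suc M + j \<le> 2 * M + 1"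
      by (auto simp: i)
    have b: "qbinom q (2 * M + 1) i = ?b j" "qbinom q (2 * M + 1) (Suc M + j) = ?b j"
      unfolding qbinom_def d using d by (simp_all add: mult.commute)
    have "q ^ ?T i / (q ^ Suc M) ^ i = q ^ ?T j / q ^ ?T M"
      using q0 arg_cong[OF e1, of "\<lambda>n. q ^ n"]
      by (subst frac_eq_eq) (simp_all only: power_add power_mult mult_eq_0_iff power_not_zero simp_thms)
    moreover have "x ^ i = x ^ Suc M * (1 / x ^ Suc j)"
      using x by (simp add: i power_add)
    ultimately have c1: "?c i = x ^ Suc M / q ^ ?T M * (?b j * (q ^ ?T j * (1 / x ^ Suc j)))"
      unfolding b power_divide by (rule combine)
    have "q ^ ?T (Suc M + j) / (q ^ Suc M) ^ (Suc M + j) = q ^ ?T j / q ^ ?T M"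
      using q0 arg_cong[OF e2, of "\<lambda>n. q ^ n"]
      by (subst frac_eq_eq) (simp_all only: power_add power_mult mult_eq_0_iff power_not_zero simp_thms)
    moreover have "x ^ (Suc M + j) = x ^ Suc M * x ^ j"
      by (rule power_add)
    ultimately have c2: "?c (Suc M + j) = x ^ Suc M / q ^ ?T M * (?b j * (q ^ ?T j * x ^ j))"
      unfolding b power_divide by (rule combine)
    show "?c (Suc M - Suc j) + ?c (Suc M + j) = x ^ Suc M / q ^ ?T M * (?b j * (q ^ ?T j * (x ^ j + 1 / x ^ Suc j)))"
      unfolding d(1) c1 c2 by (simp only: distrib_left add.commute)
  qed
  also have "\<dots> = x ^ Suc M / q ^ ?T M * (\<Sum>j<Suc M. ?b j * (q ^ ?T j * (x ^ j + 1 / x ^ Suc j)))"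
    by (simp only: sum_distrib_left)
  finally show ?thesis
    using x q0 by (simp del: power_Suc prod.lessThan_Suc sum.lessThan_Suc)
qed

end

section \<open>Passage to the limit in the triple product\<close>

lemma qpoch_tendsto:
  fixes q :: real
  assumes "0 < q" "q < 1"
  obtains L where "0 < L" "qpoch q \<longlonglongrightarrow> L"
proof -
  define T where "T = - ln q"
  have T: "0 < T" "q = exp (- T)" using assms by (auto simp: T_def)
  have ge: "exp (- (5 / 3) / T) \<le> qpoch q n" for n
    using exp_le_qprod[of T q n] T by (simp add: qpoch_def)
  have "decseq (qpoch q)"
  proof (rule decseq_SucI)
    fix n
    have "(1 - q ^ Suc n) * qpoch q n \<le> 1 * qpoch q n"
      using assms ge[of n] less_le_trans[OF exp_gt_zero ge[of n]] by (intro mult_right_mono) auto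
    then show "qpoch q (Suc n) \<le> qpoch q n"
      by (simp add: qpoch_Suc)
  qed
  then obtain L where L: "qpoch q \<longlonglongrightarrow> L"
    using ge decseq_convergent[of "qpoch q" "exp (- (5 / 3) / T)"] by blast
  \<comment> \<open>Positivity of the limit is what makes the ratios of q-Pochhammer symbols in the
    triple product tend to 1.\<close>
  have "exp (- (5 / 3) / T) \<le> L"
    using ge by (intro LIMSEQ_le_const[OF L]) auto
  then show ?thesis
    using that[OF _ L] less_le_trans[OF exp_gt_zero] by blast
qed

lemma qpoch_pos:
  fixes q :: real
  assumes "0 < q" "q < 1"
  shows "0 < qpoch q n"
  unfolding qpoch_def using assms by (intro prod_pos) (simp add: power_less_one_iff del: power_Suc)

lemma qpoch_antimono:
  fixes q :: real
  assumes "0 < q" "q < 1" "m \<le> n"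
  shows "qpoch q n \<le> qpoch q m"
  using \<open>m \<le> n\<close>
proof (induction n rule: dec_induct)
  case (step n)
  have "(1 - q ^ Suc n) * qpoch q n \<le> 1 * qpoch q n"
    using assms qpoch_pos[OF assms(1,2), of n] by (intro mult_right_mono) auto
  then show ?case
    using step by (simp add: qpoch_Suc)
qed simp

text \<open>The bilateral series of \<open>q^(n(n+1)/2) * x^n\<close> over all integers
  \<open>n\<close>: for \<open>n = - 1 - j\<close> the exponent of \<open>q\<close> is again
  \<open>j(j+1)/2\<close>, so the negative indices form the second summand.\<close>

definition full_theta :: "real \<Rightarrow> complex \<Rightarrow> complex" where
  "full_theta q x = partial_theta q x + partial_theta q (1 / x) / x"

lemma summable_norm_partial_theta:
  assumes "0 < q" "q < 1"
  shows "summable (\<lambda>j. norm (of_real q ^ (j * (j + 1) div 2) * x ^ j :: complex))"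
proof -
  have "summable (\<lambda>j. complex_of_real (q ^ (j * (j + 1) div 2) * cmod x ^ j))"
    using summable_partial_theta[OF assms, of "of_real (cmod x)"] by simp
  then have "summable (\<lambda>j. q ^ (j * (j + 1) div 2) * cmod x ^ j)"
    by (simp only: summable_complex_of_real)
  then show ?thesis
    using assms by (simp add: norm_mult norm_power)
qed

text \<open>Tannery's theorem applied to the finite identity, padded with zeros beyond
  \<open>j = M\<close>. For fixed \<open>j\<close> the coefficient \<open>c j M\<close> tends to 1,
  and it lies in \<open>[0, 1]\<close> for \<open>j <= M\<close> because \<open>qpoch q\<close>
  decreases, so \<open>norm (t j)\<close> dominates.\<close>

lemma jacobi_triple_product:
  fixes x :: complex
  assumes q: "0 < q" "q < 1" and x: "x \<noteq> 0"
  shows "(\<lambda>M. of_real (qpoch q M) * ((\<Prod>m<M. 1 + x * of_real q ^ Suc m) * (\<Prod>l<Suc M. 1 + of_real q ^ l / x)))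
    \<longlonglongrightarrow> full_theta q x"
proof -
  define t where "t j = of_real q ^ (j * (j + 1) div 2) * (x ^ j + 1 / x ^ Suc j)" for j
  define c where "c j M = qpoch q M * qpoch q (2 * M + 1) / (qpoch q (M - j) * qpoch q (M + 1 + j))" for j M
  define a where "a j M = (if j < Suc M then of_real (c j M) * t j else 0)" for j M
  note pos = qpoch_pos[OF q]
  have t: "t = (\<lambda>j. of_real q ^ (j * (j + 1) div 2) * x ^ j
      + of_real q ^ (j * (j + 1) div 2) * (1 / x) ^ j * (1 / x))"
    by (simp add: fun_eq_iff t_def distrib_left power_one_over)
  have "of_real q ^ Suc i \<noteq> (1 :: complex)" for i
  proof -
    have "q ^ Suc i < 1" using q by (intro power_Suc_less_one) auto
    then show ?thesis
      unfolding of_real_power[symmetric] of_real_eq_1_iff by simp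
  qed
  then have fin: "(\<Prod>m<M. 1 + x * of_real q ^ Suc m) * (\<Prod>l<Suc M. 1 + of_real q ^ l / x)
    = (\<Sum>j<Suc M. of_real (qpoch q (2 * M + 1) / (qpoch q (M - j) * qpoch q (M + 1 + j))) * t j)" for M
    using x q unfolding t_def of_real_divide of_real_mult of_real_qpoch
    by (intro finite_jacobi_triple_product) auto
  have prod_eq: "of_real (qpoch q M) * ((\<Prod>m<M. 1 + x * of_real q ^ Suc m) * (\<Prod>l<Suc M. 1 + of_real q ^ l / x))
      = (\<Sum>j. a j M)" for M
  proof -
    have "(\<Sum>j. a j M) = (\<Sum>j<Suc M. a j M)"
      by (intro suminf_finite) (auto simp: a_def)
    also have "\<dots> = (\<Sum>j<Suc M. of_real (qpoch q M) *
        (of_real (qpoch q (2 * M + 1) / (qpoch q (M - j) * qpoch q (M + 1 + j))) * t j))"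
      by (intro sum.cong refl) (simp add: a_def c_def)
    finally show ?thesis
      unfolding fin by (simp only: sum_distrib_left)
  qed
  obtain L where L: "0 < L" "qpoch q \<longlonglongrightarrow> L"
    using qpoch_tendsto[OF q] .
  have "(\<lambda>M. a j M) \<longlonglongrightarrow> t j" for j
  proof -
    have lim_top: "filterlim f at_top sequentially" if "\<And>Z M. Z + j \<le> M \<Longrightarrow> Z \<le> f M" for f :: "nat \<Rightarrow> nat"
      unfolding filterlim_at_top
    proof
      fix Z
      show "\<forall>\<^sub>F M in sequentially. Z \<le> f M"
        using eventually_ge_at_top[of "Z + j"] by eventually_elim (rule that)
    qed
    have 1: "filterlim (\<lambda>M. 2 * M + 1) at_top sequentially" "filterlim (\<lambda>M. M - j) at_top sequentially"
      "filterlim (\<lambda>M. M + 1 + j) at_top sequentially"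
      by (rule lim_top, simp)+
    have "(\<lambda>M. c j M) \<longlonglongrightarrow> L * L / (L * L)"
      unfolding c_def using L
      by (intro tendsto_divide tendsto_mult L(2) 1[THEN filterlim_compose[OF L(2)]]) auto
    then have "(\<lambda>M. of_real (c j M) * t j) \<longlonglongrightarrow> of_real 1 * t j"
      using L by (intro tendsto_intros) auto
    moreover have "\<forall>\<^sub>F M in sequentially. a j M = of_real (c j M) * t j"
      using eventually_ge_at_top[of j] by eventually_elim (simp add: a_def)
    ultimately show ?thesis
      by (simp add: tendsto_cong)
  qed
  moreover have bound: "norm (a j M) \<le> norm (t j)" for j M
  proof (cases "j < Suc M")
    case True
    have "qpoch q M * qpoch q (2 * M + 1) \<le> qpoch q (M - j) * qpoch q (M + 1 + j)"
      using True pos by (intro mult_mono qpoch_antimono[OF q]) (auto intro: less_imp_le)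
    then have "c j M \<le> 1"
      unfolding c_def using pos by (subst divide_le_eq_1_pos) (auto intro: mult_pos_pos)
    moreover have "0 \<le> c j M"
      unfolding c_def by (intro divide_nonneg_nonneg mult_nonneg_nonneg less_imp_le pos)
    ultimately have "\<bar>c j M\<bar> \<le> 1"
      by simp
    then show ?thesis
      using True by (simp add: a_def norm_mult mult_left_le_one_le)
  qed (simp add: a_def)
  moreover have "summable (\<lambda>j. norm (t j))"
  proof (rule summable_comparison_test')
    show "summable (\<lambda>j. norm (of_real q ^ (j * (j + 1) div 2) * x ^ j)
        + norm (of_real q ^ (j * (j + 1) div 2) * (1 / x) ^ j) * norm (1 / x))"
      by (intro summable_add summable_mult2 summable_norm_partial_theta q)
  qed (simp add: t norm_mult[symmetric] norm_triangle_ineq del: norm_mult)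
  ultimately have "(\<lambda>M. \<Sum>j. a j M) \<longlonglongrightarrow> (\<Sum>j. t j)"
    using tannerys_theorem[of a t sequentially "\<lambda>j. norm (t j)"] by (simp add: case_prod_unfold)
  moreover have "(\<Sum>j. t j) = full_theta q x"
    unfolding t full_theta_def partial_theta_def
    by (subst suminf_add[symmetric], intro summable_partial_theta q,
        intro summable_mult2 summable_partial_theta q,
        subst suminf_mult2[symmetric], intro summable_partial_theta q, simp)
  ultimately show ?thesis
    by (simp only: prod_eq)
qed

section \<open>Functional equations and factorization of the theta functions\<close>

lemma partial_theta_rec:
  assumes "0 < q" "q < 1"
  shows "partial_theta q x = 1 + of_real q * x * partial_theta q (of_real q * x)"
proof -
  let ?f = "\<lambda>x j. of_real q ^ (j * (j + 1) div 2) * x ^ j :: complex"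
  have step: "?f x (Suc j) = of_real q * x * ?f (of_real q * x) j" for j
    unfolding triangular_Suc by (simp add: power_add power_mult_distrib)
  have "partial_theta q x = ?f x 0 + (\<Sum>j. ?f x (Suc j))"
    unfolding partial_theta_def
    using suminf_split_head[OF summable_partial_theta[OF assms, of x]] by simp
  also have "(\<Sum>j. ?f x (Suc j)) = of_real q * x * partial_theta q (of_real q * x)"
    unfolding step partial_theta_def by (rule suminf_mult[OF summable_partial_theta[OF assms]])
  finally show ?thesis by simp
qed

text \<open>An index shift in the bilateral series: the constant term 1 split off from
  \<open>partial_theta q x\<close> reappears as the one split off from
  \<open>partial_theta q (1 / (q * x))\<close>.\<close>

lemma full_theta_shift:
  assumes "0 < q" "q < 1" "x \<noteq> 0"
  shows "full_theta q x = of_real q * x * full_theta q (of_real q * x)"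
proof -
  have "partial_theta q (1 / (of_real q * x)) = 1 + 1 / x * partial_theta q (1 / x)"
    using assms by (subst partial_theta_rec) auto
  then show ?thesis
    using assms unfolding full_theta_def partial_theta_rec[OF assms(1,2), of x]
    by (simp only:) (simp add: field_simps)
qed

lemma full_theta_shift_power:
  assumes "0 < q" "q < 1" "x \<noteq> 0"
  shows "full_theta q x = of_real q ^ (N * (N + 1) div 2) * x ^ N * full_theta q (of_real q ^ N * x)"
proof (induction N)
  case (Suc N)
  have "full_theta q (of_real q ^ N * x)
      = of_real q * (of_real q ^ N * x) * full_theta q (of_real q * (of_real q ^ N * x))"
    using assms by (intro full_theta_shift) auto
  then show ?case
    unfolding triangular_Suc using Suc.IH by (simp add: power_add mult_ac)
qed simp

text \<open>The factor \<open>1 - 1 / y\<close> is the one with \<open>l = 0\<close>. The rest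
  consists of three products of \<open>1 - z * q^m\<close>, for \<open>z = q\<close>,
  \<open>y * q\<close> and \<open>q / y\<close>, all of modulus at most
  \<open>exp (- T / 2)\<close>. Their lower bounds multiply to \<open>exp (- 5 / T)\<close>; the
  first product is real, so only two contribute \<open>5 / T^2\<close> to the argument.\<close>

lemma full_theta_factor:
  fixes y :: complex and T :: real
  assumes T: "0 < T" and y: "y \<noteq> 0" "y \<noteq> 1"
    and le: "cmod (y * of_real (exp (- T))) \<le> exp (- T / 2)" "cmod (of_real (exp (- T)) / y) \<le> exp (- T / 2)"
  obtains P where "full_theta (exp (- T)) (- y) = (1 - 1 / y) * P"
    "exp (- 5 / T) \<le> cmod P" "im_ratio P \<le> im_ratio y * (10 / T\<^sup>2)"
proof -
  define q where "q = exp (- T)"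
  define u where "u = y * of_real q"
  define v where "v = of_real q / y"
  have q: "0 < q" "q < 1" using T by (auto simp: q_def)
  define R where "R z M = (\<Prod>m<M. 1 - z * of_real q ^ m)" for z :: complex and M
  have u: "cmod u \<le> exp (- T / 2)" and v: "cmod v \<le> exp (- T / 2)"
    using le by (simp_all add: u_def v_def q_def)
  have qT: "cmod (of_real q) \<le> exp (- T / 2)"
    using T by (simp add: q_def del: of_real_exp)
  define F where "F M = of_real (qpoch q M) * (R u M * R v M)" for M
  have qp: "of_real (qpoch q M) = R (of_real q) M" for M
    by (simp add: R_def qpoch_def)
  have "of_real (qpoch q M) * ((\<Prod>m<M. 1 + - y * of_real q ^ Suc m) * (\<Prod>l<Suc M. 1 + of_real q ^ l / - y))
      = (1 - 1 / y) * F M" for M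
    unfolding prod.lessThan_Suc_shift by (simp add: F_def R_def u_def v_def mult_ac)
  then have "(\<lambda>M. (1 - 1 / y) * F M) \<longlonglongrightarrow> full_theta q (- y)"
    using jacobi_triple_product[OF q, of "- y"] y by simp
  then have "(\<lambda>M. (1 - 1 / y) * F M / (1 - 1 / y)) \<longlonglongrightarrow> full_theta q (- y) / (1 - 1 / y)"
    using y by (intro tendsto_intros) auto
  moreover define P where "P = full_theta q (- y) / (1 - 1 / y)"
  ultimately have lim: "F \<longlonglongrightarrow> P"
    using y by simp
  have "exp (- 5 / T) \<le> cmod (F M)" for M
  proof -
    have "exp (- 5 / T) = exp (- (5 / 3) / T) * (exp (- (5 / 3) / T) * exp (- (5 / 3) / T))"
      by (simp add: field_simps flip: exp_add)
    also have "\<dots> \<le> cmod (R (of_real q) M) * (cmod (R u M) * cmod (R v M))"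
      unfolding R_def q_def using u v qT T by (intro mult_mono exp_le_cmod_qprod) (auto simp: q_def)
    finally show ?thesis
      by (simp add: F_def qp norm_mult)
  qed
  then have "exp (- 5 / T) \<le> cmod P"
    by (intro LIMSEQ_le_const[OF tendsto_norm[OF lim]]) auto
  moreover have "im_ratio P \<le> im_ratio y * (10 / T\<^sup>2)"
  proof (rule im_ratio_lim_le[OF lim])
    show "P \<noteq> 0"
      using less_le_trans[OF exp_gt_zero \<open>exp (- 5 / T) \<le> cmod P\<close>] by simp
    fix M
    have "im_ratio (F M) = im_ratio (R u M * R v M)"
      unfolding F_def using qpoch_pos[OF q, of M] by (intro im_ratio_of_real_mult) simp
    also have "\<dots> \<le> im_ratio (R u M) + im_ratio (R v M)"
      by (rule im_ratio_mult_le)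
    also have "\<dots> \<le> im_ratio u * (5 / T\<^sup>2) + im_ratio v * (5 / T\<^sup>2)"
      unfolding R_def q_def using u v T by (intro add_mono im_ratio_qprod_le) (auto simp: q_def)
    also have "im_ratio u = im_ratio y"
      unfolding u_def using q by (intro im_ratio_mult_of_real) simp
    also have "im_ratio v = im_ratio y"
      unfolding v_def divide_inverse using q by (subst im_ratio_of_real_mult) (auto simp: im_ratio_inverse)
    finally show "im_ratio (F M) \<le> im_ratio y * (10 / T\<^sup>2)"
      by (simp add: field_simps)
  qed
  moreover have "full_theta q (- y) = (1 - 1 / y) * P"
    using y by (simp add: P_def)
  ultimately show ?thesis
    using that q_def by blast
qed

text \<open>All powers of \<open>q\<close> are at most 1, so everything beyond the leading term 1 is
  dominated by a geometric series of sum at most \<open>(1/49) / (48/49) = 1/48\<close>.\<close>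

lemma partial_theta_near_0:
  assumes q: "0 < q" "q < 1" and z: "cmod z \<le> 1 / 49"
  shows "cmod (partial_theta q z) \<le> 49 / 48"
    and "47 / 48 \<le> cmod (partial_theta q z)"
    and "im_ratio (partial_theta q z) \<le> im_ratio z / 10"
proof -
  let ?f = "\<lambda>j. of_real q ^ (j * (j + 1) div 2) * z ^ j :: complex"
  define S where "S = (\<Sum>j. ?f (Suc j))"
  have pow: "0 \<le> q ^ n" "q ^ n \<le> 1" for n
    using q by (auto intro: power_le_one)
  have sm: "summable (\<lambda>j. ?f (Suc j))"
    by (rule summable_Suc_iff[of ?f, THEN iffD2, OF summable_partial_theta[OF q]])
  have eq: "partial_theta q z = 1 + S"
    using suminf_split_head[OF summable_partial_theta[OF q, of z]] by (simp add: S_def partial_theta_def)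
  have geo: "(\<lambda>j. w ^ Suc j) sums (w / (1 - w))" if "0 \<le> w" "w < 1" for w :: real
    using sums_mult[OF geometric_sums[of w], of w] that by simp
  have "cmod S \<le> (\<Sum>j. cmod z ^ Suc j)"
    unfolding S_def
  proof (rule norm_suminf_le)
    show "norm (?f (Suc j)) \<le> cmod z ^ Suc j" for j
      using q unfolding norm_mult norm_power norm_of_real
      by (intro mult_left_le_one_le) (simp_all only: abs_of_pos pow zero_le_power norm_ge_zero)
    show "summable (\<lambda>j. cmod z ^ Suc j)"
      using geo[of "cmod z"] z by (auto simp: sums_iff)
  qed
  also have "\<dots> = cmod z / (1 - cmod z)"
    using geo[of "cmod z"] z by (auto simp: sums_iff)
  also have "\<dots> \<le> (1 / 49) / (1 - 1 / 49)"
    using z by (intro frac_le) auto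
  finally have S: "cmod S \<le> 1 / 48" by simp
  show up: "cmod (partial_theta q z) \<le> 49 / 48"
    unfolding eq using S norm_triangle_ineq[of 1 S] by simp
  show lo: "47 / 48 \<le> cmod (partial_theta q z)"
    unfolding eq using S norm_diff_ineq[of 1 S] by simp
  \<comment> \<open>Smallness of \<open>S\<close> alone gives no bound proportional to
    \<open>im_ratio z\<close>, so imaginary parts are estimated termwise; the factor
    \<open>n\<close> from \<open>im_ratio_power_le\<close> is absorbed by \<open>n <= 2^n\<close>,
    giving a geometric series of ratio \<open>2 * cmod z\<close>.\<close>
  have "\<bar>Im S\<bar> = norm (\<Sum>j. Im (?f (Suc j)))"
    unfolding S_def using sm by (simp add: Im_suminf)
  also have "\<dots> \<le> (\<Sum>j. im_ratio z * (2 * cmod z) ^ Suc j)"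
  proof (rule norm_suminf_le)
    fix j
    have "Im (of_real d * w) = d * Im w" for d w
      by simp
    then have "Im (?f (Suc j)) = q ^ (Suc j * (Suc j + 1) div 2) * Im (z ^ Suc j)"
      unfolding of_real_power[symmetric] .
    then have "norm (Im (?f (Suc j))) = q ^ (Suc j * (Suc j + 1) div 2) * \<bar>Im (z ^ Suc j)\<bar>"
      using q by (simp only: real_norm_def abs_mult) simp
    also have "\<dots> \<le> \<bar>Im (z ^ Suc j)\<bar>"
      by (intro mult_left_le_one_le pow) simp
    also have "\<dots> = im_ratio (z ^ Suc j) * cmod z ^ Suc j"
      unfolding abs_Im_eq_im_ratio norm_power ..
    also have "\<dots> \<le> (real (Suc j) * im_ratio z) * cmod z ^ Suc j"
      by (intro mult_right_mono im_ratio_power_le) simp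
    also have "\<dots> \<le> (2 ^ Suc j * im_ratio z) * cmod z ^ Suc j"
      using of_nat_less_two_power[of "Suc j", where ?'a = real]
      by (intro mult_right_mono im_ratio_nonneg) (auto simp del: of_nat_Suc power_Suc)
    also have "\<dots> = im_ratio z * (2 * cmod z) ^ Suc j"
      by (simp only: power_mult_distrib mult_ac)
    finally show "norm (Im (?f (Suc j))) \<le> im_ratio z * (2 * cmod z) ^ Suc j" .
  next
    show "summable (\<lambda>j. im_ratio z * (2 * cmod z) ^ Suc j)"
      using geo[of "2 * cmod z"] z by (intro summable_mult) (auto simp: sums_iff)
  qed
  also have "\<dots> = im_ratio z * (2 * cmod z / (1 - 2 * cmod z))"
    using sums_mult[OF geo[of "2 * cmod z"], of "im_ratio z"] z by (auto simp: sums_iff)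
  also have "\<dots> \<le> im_ratio z * ((2 / 49) / (1 - 2 / 49))"
    using z by (intro mult_left_mono frac_le im_ratio_nonneg) auto
  finally have "\<bar>Im (partial_theta q z)\<bar> \<le> im_ratio z * (2 / 47)"
    by (simp add: eq)
  then have "im_ratio (partial_theta q z) \<le> (im_ratio z * (2 / 47)) / (47 / 48)"
    unfolding im_ratio_def[of "partial_theta q z"] using lo im_ratio_nonneg[of z] by (intro frac_le) auto
  also have "\<dots> \<le> im_ratio z / 10"
    using im_ratio_nonneg[of z] by simp
  finally show "im_ratio (partial_theta q z) \<le> im_ratio z / 10" .
qed

section \<open>Zeros of large modulus\<close>

text \<open>The numerical clash: \<open>K\<close> measures how close \<open>y\<close> is to 1, and
  the last factor bounds the argument of \<open>y - 1\<close> relative to that of \<open>y\<close>.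
  Since \<open>a^2 / 2 > 5\<close>, \<open>K\<close> decays exponentially in \<open>1 / T\<close>
  and beats the polynomial; \<open>exp (- a / 2) <= 1/7\<close> settles large
  \<open>T\<close>.\<close>

lemma closeness_times_argument_less_1:
  fixes a T K :: real
  assumes a: "39 / 10 \<le> a" "7 \<le> exp (a / 2)" and T: "0 < T"
  defines "K \<equiv> 49 / 48 * exp (5 / T - a\<^sup>2 / (2 * T) - a / 2)"
  shows "K * (1 + K) ^ 3 * (a / T + 6 / 10 + 10 / T\<^sup>2) < 1"
proof -
  define u where "u = 1 / T"
  define E where "E = exp (- (a / 2))"
  \<comment> \<open>The quadratic Taylor polynomial of \<open>exp (2.6 * u)\<close>; the rate 2.6 is
    a lower bound for \<open>a^2 / 2 - 5\<close>, as \<open>3.9^2 / 2 = 7.605\<close>.\<close>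
  define V where "V = 1 + 26 / 10 * u + 338 / 100 * u\<^sup>2"
  have u: "0 < u" using T by (simp add: u_def)
  have V: "1 \<le> V" using u by (simp add: V_def)
  have E7: "E \<le> 1 / 7"
    using a(2) by (simp add: E_def exp_minus divide_simps)
  have aE: "a * E \<le> 5 / 6"
  proof -
    have "0 \<le> (a / 2 - 14 / 10)\<^sup>2 + 4 / 100"
      by simp
    then have "6 / 5 * a \<le> 1 + a / 2 + (a / 2)\<^sup>2 / 2"
      by (simp add: power2_eq_square algebra_simps)
    also have "\<dots> \<le> exp (a / 2)"
      using a by (intro exp_lower_Taylor_quadratic) simp
    finally show ?thesis
      by (simp add: E_def exp_minus field_simps)
  qed
  have "26 / 10 \<le> a\<^sup>2 / 2 - 5"
    using power_mono[OF a(1), of 2] by (simp add: power2_eq_square)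
  then have "26 / 10 * u \<le> (a\<^sup>2 / 2 - 5) * u"
    using u by (intro mult_right_mono) auto
  also have "\<dots> = - (5 / T - a\<^sup>2 / (2 * T))"
    by (simp add: u_def diff_divide_distrib)
  finally have "exp (5 / T - a\<^sup>2 / (2 * T)) \<le> exp (- (26 / 10 * u))"
    by simp
  also have "\<dots> \<le> 1 / V"
  proof -
    have "V \<le> exp (26 / 10 * u)"
      using exp_lower_Taylor_quadratic[of "26 / 10 * u"] u by (simp add: V_def power2_eq_square)
    then show ?thesis
      using V by (simp add: exp_minus inverse_eq_divide frac_le)
  qed
  finally have "exp (5 / T - a\<^sup>2 / (2 * T)) * E \<le> 1 / V * E"
    by (intro mult_right_mono) (auto simp: E_def)
  then have KV: "K \<le> 49 / 48 * E / V"
    by (simp add: K_def E_def flip: exp_add)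
  have E0: "0 < E" by (simp add: E_def)
  have K0: "0 < K" by (simp add: K_def)
  have "49 / 48 * E / V \<le> (49 / 48 * (1 / 7)) / 1"
    using E7 V E0 by (intro frac_le) auto
  then have "K \<le> 7 / 48"
    using KV by simp
  then have "(1 + K) ^ 3 \<le> (1 + 7 / 48) ^ 3"
    using K0 by (intro power_mono) auto
  also have "\<dots> \<le> 151 / 100"
    by (simp add: power3_eq_cube)
  finally have K3: "(1 + K) ^ 3 \<le> 151 / 100" .
  have "a / T + 6 / 10 + 10 / T\<^sup>2 = a * u + 6 / 10 + 10 * u\<^sup>2" (is "?B = _")
    by (simp add: u_def power_divide)
  then have B: "E * ?B = a * E * u + 6 / 10 * E + 10 * u\<^sup>2 * E"
    by (simp only:) (simp add: algebra_simps)
  have "a * E * u \<le> 5 / 6 * u" "10 * u\<^sup>2 * E \<le> 10 * u\<^sup>2 * (1 / 7)"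
    using aE E7 u by (auto intro: mult_right_mono mult_left_mono)
  then have EB: "E * ?B \<le> 5 / 6 * u + 6 / 70 + 10 / 7 * u\<^sup>2"
    unfolding B using E7 by linarith
  have B0: "0 \<le> ?B" using a T by simp
  have "K * (1 + K) ^ 3 * ?B \<le> (49 / 48 * E / V) * (151 / 100) * ?B"
    using KV K3 K0 E0 V B0 by (intro mult_right_mono mult_mono) auto
  also have "\<dots> = (7399 / 4800 * (E * ?B)) / V"
    by simp
  also have "\<dots> \<le> (8 / 5 * (5 / 6 * u + 6 / 70 + 10 / 7 * u\<^sup>2)) / V"
    using EB E0 B0 V by (intro divide_right_mono mult_mono) auto
  also have "8 / 5 * (5 / 6 * u + 6 / 70 + 10 / 7 * u\<^sup>2) = 4 / 3 * u + 24 / 175 + 16 / 7 * u\<^sup>2"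
    by (simp add: algebra_simps)
  \<comment> \<open>The numerator lies below \<open>V\<close> coefficient by coefficient.\<close>
  also have "(4 / 3 * u + 24 / 175 + 16 / 7 * u\<^sup>2) / V < 1"
  proof -
    have "4 / 3 * u \<le> 26 / 10 * u" "16 / 7 * u\<^sup>2 \<le> 338 / 100 * u\<^sup>2"
      using u by (auto intro!: mult_right_mono)
    then have "4 / 3 * u + 24 / 175 + 16 / 7 * u\<^sup>2 < V"
      unfolding V_def by linarith
    then show ?thesis using V by simp
  qed
  finally show ?thesis .
qed

text \<open>Closeness of \<open>y\<close> to 1 limits its modulus \<open>exp l\<close>. In terms of
  \<open>g = exp (|l| / 4)\<close> both signs of \<open>l\<close> lead to
  \<open>g^4 - 1 <= K * g^3\<close>, for negative \<open>l\<close> after multiplication by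
  \<open>exp (- l)\<close>.\<close>

lemma exp_quarter_abs_le:
  fixes l K :: real
  assumes "\<bar>exp l - 1\<bar> \<le> K * exp (\<bar>l\<bar> / 4 + l / 2)"
  shows "exp (\<bar>l\<bar> / 4) \<le> 1 + K"
proof -
  define g where "g = exp (\<bar>l\<bar> / 4)"
  have g: "1 \<le> g" by (simp add: g_def)
  have g4: "g ^ n = exp (real n * \<bar>l\<bar> / 4)" for n
    by (simp add: g_def flip: exp_of_nat_mult)
  have "g ^ 4 - 1 \<le> K * g ^ 3"
  proof (cases "0 \<le> l")
    case True
    then show ?thesis
      using assms unfolding g4 by simp
  next
    case False
    have "1 - exp l \<le> K * exp (\<bar>l\<bar> / 4 + l / 2)"
      using assms by simp
    then have "exp (- l) * (1 - exp l) \<le> exp (- l) * (K * exp (\<bar>l\<bar> / 4 + l / 2))"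
      by (intro mult_left_mono) auto
    also have "\<dots> = K * exp (3 * \<bar>l\<bar> / 4)"
      using False by (simp add: mult.left_commute flip: exp_add)
    finally show ?thesis
      using False unfolding g4 by (simp add: right_diff_distrib flip: exp_add)
  qed
  moreover have "(g - 1) * g ^ 3 \<le> g ^ 4 - 1"
    using one_le_power[OF g, of 3] by (simp add: algebra_simps power4_eq_xxxx power3_eq_cube)
  ultimately have "(g - 1) * g ^ 3 \<le> K * g ^ 3"
    by linarith
  then have "g - 1 \<le> K"
    using g by (simp add: mult_le_cancel_right)
  then show ?thesis by (simp add: g_def)
qed

lemma partial_theta_large_zero_real:
  fixes q :: real and x :: complex
  assumes q: "0 < q" "q < 1" and zero: "partial_theta q x = 0" and large: "49.8 \<le> cmod x"
  shows "x \<in> \<real>"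
proof (rule ccontr)
  assume nonreal: "x \<notin> \<real>"
  define T where "T = - ln q"
  define a where "a = ln (cmod x)"
  define N where "N = nat (round (a / T))"
  define l where "l = a - real N * T"
  define y where "y = - (of_real q ^ N * x)"
  have T: "0 < T" and qT: "q = exp (- T)"
    using q by (auto simp: T_def)
  have x0: "x \<noteq> 0"
    using large by auto
  then have r: "cmod x = exp a"
    by (simp add: a_def)
  \<comment> \<open>The radius 49.8 lies just above \<open>exp 3.9\<close>; tenth powers make this a
    rational comparison through \<open>e < 2.72\<close>.\<close>
  have a: "39 / 10 \<le> a"
  proof -
    have "exp (39 / 10) ^ 10 = (exp 1 :: real) ^ 39"
      by (simp flip: exp_of_nat_mult)
    also have "\<dots> \<le> (272 / 100) ^ 39"
      using e_less_272 by (intro power_mono) auto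
    also have "\<dots> \<le> (49.8 :: real) ^ 10"
      by (simp add: power_divide divide_simps)
    finally have "exp (39 / 10) \<le> (49.8 :: real)"
      by (subst (asm) power_mono_iff) auto
    then show ?thesis
      using large r by (metis exp_le_cancel_iff order.trans)
  qed
  have "7\<^sup>2 \<le> exp (a / 2) ^ 2"
    using large r by (simp add: power2_eq_square flip: exp_add)
  then have a7: "7 \<le> exp (a / 2)"
    by (rule power2_le_imp_le) simp
  \<comment> \<open>As \<open>a / T > 0\<close>, the conversion by \<open>nat\<close> loses
    nothing.\<close>
  have "real N = of_int (round (a / T))"
    using a T by (simp add: N_def round_def)
  then have round: "\<bar>real N - a / T\<bar> \<le> 1 / 2"
    using of_int_round_abs_le[of "a / T"] by simp
  then have N: "real N \<le> a / T + 1 / 2"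
    by linarith
  have "\<bar>(real N - a / T) * T\<bar> \<le> 1 / 2 * T"
    unfolding abs_mult using round T by (intro mult_mono) auto
  moreover have "(real N - a / T) * T = - l"
    using T by (simp add: l_def field_simps)
  ultimately have l: "\<bar>l\<bar> \<le> T / 2"
    by simp
  have qN: "q ^ N = exp (l - a)"
    by (simp add: qT l_def algebra_simps flip: exp_of_nat_mult)
  have cmod_y: "cmod y = exp l"
    using q by (simp add: y_def norm_mult norm_power r qN flip: exp_add)
  have im_y: "im_ratio y = im_ratio x"
    unfolding y_def im_ratio_minus of_real_power[symmetric] using q by (intro im_ratio_of_real_mult) simp
  have Im_x: "Im x \<noteq> 0"
    using nonreal by (simp add: complex_is_Real_iff)
  then have im_pos: "0 < im_ratio y"
    unfolding im_y using x0 by (simp add: im_ratio_def)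
  have y: "y \<noteq> 0" "y \<noteq> 1"
    using im_pos by (auto simp: im_ratio_def)
  obtain P where P: "full_theta q (- y) = (1 - 1 / y) * P"
    "exp (- 5 / T) \<le> cmod P" "im_ratio P \<le> im_ratio y * (10 / T\<^sup>2)"
  proof (rule full_theta_factor[OF T y])
    have "cmod (y * of_real (exp (- T))) = exp (l - T)"
      by (simp add: norm_mult cmod_y del: of_real_exp flip: exp_add)
    also have "\<dots> \<le> exp (- T / 2)"
      using l by simp
    finally show "cmod (y * of_real (exp (- T))) \<le> exp (- T / 2)" .
    have "cmod (of_real (exp (- T)) / y) = exp (- T - l)"
      by (simp add: norm_divide cmod_y exp_diff del: of_real_exp)
    also have "\<dots> \<le> exp (- T / 2)"
      using l by simp
    finally show "cmod (of_real (exp (- T)) / y) \<le> exp (- T / 2)" .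
  qed (auto simp: qT)
  have P0: "P \<noteq> 0"
    using less_le_trans[OF exp_gt_zero P(2)] by simp
  define \<theta> where "\<theta> = partial_theta q (1 / x)"
  define c where "c = - (q ^ N / q ^ (N * (N + 1) div 2))"
  have c0: "c \<noteq> 0" using q by (simp add: c_def)
  \<comment> \<open>At a zero of \<open>partial_theta q\<close> only the second summand of
    \<open>full_theta q x\<close> survives.\<close>
  have "\<theta> / x = of_real q ^ (N * (N + 1) div 2) * x ^ N * ((1 - 1 / y) * P)"
    using full_theta_shift_power[OF q x0, of N] zero P(1)
    by (simp add: full_theta_def \<theta>_def y_def)
  then have "y * \<theta> = x * of_real q ^ (N * (N + 1) div 2) * x ^ N * ((y - 1) * P)"
    using x0 y by (simp add: field_simps)
  then have "x * (- (of_real q ^ N) * \<theta>) = x * (of_real q ^ (N * (N + 1) div 2) * x ^ N * ((y - 1) * P))"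
    by (simp add: y_def mult_ac)
  then have eqn: "- (of_real q ^ N) * \<theta> = of_real q ^ (N * (N + 1) div 2) * x ^ N * ((y - 1) * P)"
    using x0 by (simp only: mult_cancel_left) simp
  have solve: "Y = - (A / B) * (t * inverse (X * P))"
    if "- A * t = B * X * (Y * P)" "B \<noteq> 0" "X \<noteq> 0" for A B X Y t :: complex
    using that P0 by (simp add: field_simps)
  have c_eq: "complex_of_real c = - (of_real q ^ N / of_real q ^ (N * (N + 1) div 2))"
    by (simp add: c_def)
  have y1: "y - 1 = of_real c * (\<theta> * inverse (x ^ N * P))"
    unfolding c_eq by (rule solve[OF eqn]) (use x0 q in auto)
  have x_small: "cmod (1 / x) \<le> 1 / 49"
    using large by (simp add: norm_divide divide_simps)
  note \<theta> = partial_theta_near_0[OF q x_small, folded \<theta>_def]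
  define K where "K = 49 / 48 * exp (5 / T - a\<^sup>2 / (2 * T) - a / 2)"
  have K0: "0 < K" by (simp add: K_def)
  have near: "cmod (y - 1) \<le> K * exp (\<bar>l\<bar> / 4 + l / 2)"
  proof -
    have tri: "real (N * (N + 1) div 2) = real N * (real N + 1) / 2"
    proof -
      have "real (2 * (N * (N + 1) div 2)) = real (N * (N + 1))"
        by (simp only: double_triangular)
      then have "2 * real (N * (N + 1) div 2) = real N * (real N + 1)"
        by (simp only: of_nat_mult of_nat_add of_nat_numeral of_nat_1)
      moreover have "s = t / 2" if "2 * s = t" for s t :: real
        using that by simp
      ultimately show ?thesis by blast
    qed
    have cexp: "\<bar>c\<bar> = exp (T * real N * (real N - 1) / 2)"
    proof -
      have "\<bar>c\<bar> = q ^ N / q ^ (N * (N + 1) div 2)"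
        using q by (simp add: c_def abs_divide)
      also have "\<dots> = exp (- T * real N - - T * real (N * (N + 1) div 2))"
        unfolding qT exp_of_nat_mult[symmetric] exp_diff by (simp add: mult.commute)
      also have "\<dots> = exp (T * real N * (real N - 1) / 2)"
        unfolding tri by (simp add: field_simps)
      finally show ?thesis .
    qed
    have "cmod (y - 1) = \<bar>c\<bar> * cmod \<theta> * inverse (cmod x ^ N) * inverse (cmod P)"
      by (simp add: y1 norm_mult norm_inverse norm_power)
    also have "\<dots> \<le> \<bar>c\<bar> * (49 / 48) * inverse (cmod x ^ N) * inverse (exp (- 5 / T))"
      using \<theta>(1) P(2) x0 by (intro mult_mono le_imp_inverse_le) auto
    also have "\<dots> = 49 / 48 * exp (T * real N * (real N - 1) / 2 - a * real N + 5 / T)"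
    proof -
      have "inverse (exp a ^ N) = exp (- (a * real N))" "inverse (exp (- 5 / T)) = exp (5 / T)"
        by (simp_all add: exp_minus mult.commute flip: exp_of_nat_mult)
      then show ?thesis
        unfolding cexp r by (simp only: exp_add diff_conv_add_uminus mult_ac)
    qed
    \<comment> \<open>Completing the square with \<open>N * T = a - l\<close>: the mixed terms
      \<open>a * l / T\<close> cancel and the Gaussian \<open>- a^2 / (2 * T)\<close>
      appears.\<close>
    also have "T * real N * (real N - 1) / 2 - a * real N + 5 / T
        = 5 / T - a\<^sup>2 / (2 * T) - a / 2 + (l\<^sup>2 / (2 * T) + l / 2)"
      using T by (simp add: l_def field_simps power2_eq_square)
    also have "l\<^sup>2 / (2 * T) \<le> \<bar>l\<bar> / 4"
    proof -
      have "l\<^sup>2 = \<bar>l\<bar> * \<bar>l\<bar>" by (simp add: power2_eq_square)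
      also have "\<dots> \<le> \<bar>l\<bar> * (T / 2)" using l by (intro mult_left_mono) auto
      finally show ?thesis using T by (simp add: field_simps)
    qed
    finally show ?thesis
      by (simp add: K_def exp_add mult.assoc)
  qed
  have "\<bar>exp l - 1\<bar> \<le> cmod (y - 1)"
    using norm_triangle_ineq3[of y 1] by (simp add: cmod_y)
  then have g: "exp (\<bar>l\<bar> / 4) \<le> 1 + K"
    using near by (intro exp_quarter_abs_le) linarith
  have "im_ratio (y - 1) \<le> im_ratio y * (1 / 10 + real N + 10 / T\<^sup>2)"
  proof -
    have "im_ratio (y - 1) = im_ratio (\<theta> * inverse (x ^ N * P))"
      unfolding y1 using c0 by (rule im_ratio_of_real_mult)
    also have "\<dots> \<le> im_ratio \<theta> + im_ratio (inverse (x ^ N * P))"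
      by (rule im_ratio_mult_le)
    also have "\<dots> \<le> im_ratio \<theta> + (im_ratio (x ^ N) + im_ratio P)"
      unfolding im_ratio_inverse by (intro add_left_mono im_ratio_mult_le)
    also have "\<dots> \<le> im_ratio (1 / x) / 10 + (real N * im_ratio x + im_ratio y * (10 / T\<^sup>2))"
      by (intro add_mono \<theta>(3) im_ratio_power_le P(3))
    also have "im_ratio (1 / x) = im_ratio y"
      using im_ratio_inverse[of x] by (simp add: im_y inverse_eq_divide)
    finally show ?thesis
      by (simp add: im_y algebra_simps)
  qed
  \<comment> \<open>The constant 6/10 collects 1/10 from \<open>\<theta>\<close> and 1/2 from
    rounding \<open>a / T\<close> to \<open>N\<close>.\<close>
  also have "\<dots> \<le> im_ratio y * (a / T + 6 / 10 + 10 / T\<^sup>2)"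
    using N by (intro mult_left_mono im_ratio_nonneg) simp
  finally have ratio: "im_ratio (y - 1) \<le> im_ratio y * (a / T + 6 / 10 + 10 / T\<^sup>2)" (is "_ \<le> _ * ?B") .
  have B0: "0 \<le> ?B" using a T by simp
  \<comment> \<open>\<open>Im y\<close> is computed twice, from \<open>y\<close> and from
    \<open>y - 1\<close>. As \<open>im_ratio y > 0\<close>, it cancels and leaves an inequality
    between moduli.\<close>
  have "im_ratio y * exp l = \<bar>Im (y - 1)\<bar>"
    using abs_Im_eq_im_ratio[of y] by (simp add: cmod_y)
  also have "\<dots> = im_ratio (y - 1) * cmod (y - 1)"
    by (rule abs_Im_eq_im_ratio)
  also have "\<dots> \<le> (im_ratio y * ?B) * (K * exp (\<bar>l\<bar> / 4 + l / 2))"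
    using ratio near B0 by (intro mult_mono mult_nonneg_nonneg im_ratio_nonneg) auto
  finally have "im_ratio y * exp l \<le> im_ratio y * (?B * (K * exp (\<bar>l\<bar> / 4 + l / 2)))"
    by (simp only: mult.assoc)
  then have "exp l \<le> ?B * (K * exp (\<bar>l\<bar> / 4 + l / 2))"
    using im_pos by simp
  \<comment> \<open>By \<open>- l / 2 <= |l| / 2\<close>, the exponent is enlarged until
    \<open>exp l\<close> splits off and only a cube of \<open>exp (|l| / 4) <= 1 + K\<close>
    remains.\<close>
  also have "\<dots> \<le> ?B * (K * exp (l + 3 * (\<bar>l\<bar> / 4)))"
    using B0 K0 by (intro mult_left_mono) (auto simp: abs_if)
  also have "\<dots> = exp l * (K * exp (\<bar>l\<bar> / 4) ^ 3 * ?B)"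
    by (simp add: exp_add mult_ac flip: exp_of_nat_mult)
  finally have "1 \<le> K * exp (\<bar>l\<bar> / 4) ^ 3 * ?B"
    by simp
  also have "\<dots> \<le> K * (1 + K) ^ 3 * ?B"
    using g K0 B0 by (intro mult_right_mono mult_left_mono power_mono) auto
  also have "\<dots> < 1"
    unfolding K_def by (rule closeness_times_argument_less_1[OF a a7 T])
  finally show False by simp
qed

theorem theorem3:
  fixes q :: real and x :: complex
  assumes "0 < q" and "q < 1"
    and "partial_theta q x = 0"
    and "x \<notin> \<real>"
    and "Re x < 0"
  shows "{x, cnj x} \<subseteq> {z. Re z < 0 \<and> norm z < 49.8}"
proof -
  have "norm x < 49.8"
    using partial_theta_large_zero_real[OF assms(1-3)] assms(4) by linarith
  then show ?thesis
    using assms(5) by simp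
qed

end
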